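(* The cross product of $\mathbb R^{3,3}$ is induced by the trivector $$C_3=\mathcal F(e_1)+\mathcal F(e_2)+\mathcal F(e_3)=E_{12'3'}+E_{23'1'}+E_{31'2'}\in\Lambda^3(\mathbb R^{3,3}),$$ in the sense that for any $X,Y\in\mathbb R^{3,3}$, $$X\times Y=-(X\wedge Y)\cdot C_3.$$ Furthermore, for $X=(x,y)^T\in\mathbb R^{3,3}$ with $x,y\in\mathbb R^3$, $$X\cdot C_3=E'E'(y)-(E_>E'-E_<E')(x)\in se(3),$$ where $se(3)$ is taken in bivector form.
   Context: Let $e_0,e_1,e_2,e_3$ be the standard orthonormal basis of $\mathbb R^4$ and identify $\mathbb R^3=\mathrm{span}(e_1,e_2,e_3)$. $\mathbb R^{3,3}=\Lambda^2(\mathbb R^4)$ has basis $E_i=e_0\wedge e_i$ ($i=1,2,3$), $E_1'=e_2\wedge e_3$, $E_2'=e_3\wedge e_1$, $E_3'=e_1\wedge e_2$ and symmetric bilinear form $E_i\cdot E_j'=\delta_{ij}$, $E_i\cdot E_j=E_i'\cdot E_j'=0$. $(x,y)^T$ denotes $E(x)+E'(y)$ with $E(x)=\sum x_iE_i$, $E'(y)=\sum y_iE_i'$. Multi-indexed $E$'s are wedge products, e.g. $E_{12'3'}=E_1\wedge E_2'\wedge E_3'$. For $x\in\mathbb R^3$: $E'E'(x)=x_1E_{2'3'}+x_2E_{3'1'}+x_3E_{1'2'}$; $E_<E'(x)=x_1E_{23'}+x_2E_{31'}+x_3E_{12'}$; $E_>E'(x)=x_1E_{32'}+x_2E_{13'}+x_3E_{21'}$.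 Inner products in $\Lambda(\mathbb R^{3,3})$: for a vector $a$, $a\cdot(b_1\wedge\cdots\wedge b_r)=\sum_i(-1)^{i-1}(a\cdot b_i)\,b_1\wedge\cdots\widehat{b_i}\cdots\wedge b_r$, and $(a\wedge b)\cdot C=a\cdot(b\cdot C)$ for a trivector $C$. The cross product of $\mathbb R^{3,3}$ is $\begin{pmatrix} x_1 \\ y_1 \end{pmatrix}\times\begin{pmatrix} x_2 \\ y_2 \end{pmatrix}=\begin{pmatrix} x_1\times x_2 \\ x_1\times y_2+y_1\times x_2 \end{pmatrix}$. With $J_3=E_{1'2'3'}$, $I_3=E_{123}$, $K_2=E_{11'}+E_{22'}+E_{33'}$, $\mathcal F(x_0e_0+x)=E(x)\wedge(E(x)\cdot J_3)-x_0E(x)\wedge K_2+x_0^2I_3$ for $x\in\mathbb R^3$. $se(3)$ is the Lie algebra of matrices $\begin{pmatrix} 0 & 0 \\ t & [v]_\times \end{pmatrix}\in sl(4)$ ($[v]_\times p=v\times p$). The bivector form of $M\in sl(4)$ is the unique bivector $B\in\Lambda^2(\mathbb R^{3,3})$ whose Clifford commutator satisfies $B\mathbf X-\mathbf XB=(M\otimes I+I\otimes M)\mathbf X$ for all $\mathbf X\in\Lambda^2(\mathbb R^4)$, where $(M\otimes I+I\otimes M)(a\wedge b)=Ma\wedge b+a\wedge Mb$. *)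

theory Defs
  imports "HOL-Analysis.Analysis"
begin

section \<open>Exterior algebra of a coordinate space\<close>

text \<open>
  The exterior algebra of \<open>real^'n\<close>, for a finite linearly ordered index type \<open>'n\<close>, is
  represented on its standard basis: the coordinate at a set \<open>S = {i1 < ... < ir}\<close> belongs to
  the blade \<open>axis i1 1 \<and> ... \<and> axis ir 1\<close>.
\<close>

type_synonym 'n multivector = "real ^ ('n set)"

definition grade :: "nat \<Rightarrow> ('n::finite) multivector set" where
  "grade k = {A. \<forall>S. card S \<noteq> k \<longrightarrow> A $ S = 0}"

definition scal :: "real \<Rightarrow> ('n::finite) multivector" where
  "scal c = c *\<^sub>R axis {} 1"

definition vec1 :: "real ^ 'n \<Rightarrow> ('n::finite) multivector" where
  "vec1 a = (\<Sum>i\<in>UNIV. (a $ i) *\<^sub>R axis {i} 1)"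

text \<open>The sign that sorts the concatenation of two increasing index sequences.\<close>

definition merge_sign :: "('n::{finite,linorder}) set \<Rightarrow> 'n set \<Rightarrow> real" where
  "merge_sign S T = (-1) ^ card {(s, t). s \<in> S \<and> t \<in> T \<and> t < s}"

definition wedge ::
    "('n::{finite,linorder}) multivector \<Rightarrow> 'n multivector \<Rightarrow> 'n multivector"
    (infixr "\<curlywedge>" 75) where
  "A \<curlywedge> B = (\<chi> S. \<Sum>T\<in>Pow S. merge_sign T (S - T) * (A $ T) * (B $ (S - T)))"


section \<open>The space \<open>R33\<close> and its multivectors\<close>

text \<open>
  Any linear order on the six basis indices would do; here the indices \<open>Inl i\<close> of \<open>E\<^sub>i\<close>
  precede the indices \<open>Inr i\<close> of \<open>E\<^sub>i'\<close>.
\<close>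

instantiation sum :: (linorder, linorder) linorder
begin

definition less_eq_sum :: "'a + 'b \<Rightarrow> 'a + 'b \<Rightarrow> bool" where
  "p \<le> q = (case p of
      Inl a \<Rightarrow> (case q of Inl b \<Rightarrow> a \<le> b | Inr _ \<Rightarrow> True)
    | Inr a \<Rightarrow> (case q of Inl _ \<Rightarrow> False | Inr b \<Rightarrow> a \<le> b))"

definition less_sum :: "'a + 'b \<Rightarrow> 'a + 'b \<Rightarrow> bool" where
  "(p :: 'a + 'b) < q \<longleftrightarrow> p \<le> q \<and> \<not> q \<le> p"

instance
  by standard (auto simp: less_eq_sum_def less_sum_def split: sum.splits)

end

type_synonym R33 = "real ^ (3 + 3)"
type_synonym mv33 = "(3 + 3) multivector"

definition col :: "real ^ 3 \<Rightarrow> real ^ 3 \<Rightarrow> R33" where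
  "col x y = (\<chi> k. case k of Inl i \<Rightarrow> x $ i | Inr i \<Rightarrow> y $ i)"

definition E :: "real ^ 3 \<Rightarrow> R33" where "E x = col x 0"
definition E' :: "real ^ 3 \<Rightarrow> R33" where "E' y = col 0 y"

text \<open>The basis vectors as elements of the exterior algebra of \<open>R33\<close>.\<close>

definition EI :: "3 \<Rightarrow> mv33" where "EI i = vec1 (E (axis i 1))"
definition EI' :: "3 \<Rightarrow> mv33" where "EI' i = vec1 (E' (axis i 1))"

definition form33 :: "R33 \<Rightarrow> R33 \<Rightarrow> real" where
  "form33 X Y = (\<Sum>i\<in>UNIV. X $ Inl i * Y $ Inr i + X $ Inr i * Y $ Inl i)"

text \<open>
  Inner product of a vector with a multivector.  The coordinate at \<open>S\<close> collects the blades
  with index set \<open>insert i S\<close>, in which \<open>i\<close> is preceded by the elements of \<open>S\<close> below it; see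
  \<open>contract_wedge_list\<close> for the formula on arbitrary products of vectors.
\<close>

definition contract :: "R33 \<Rightarrow> mv33 \<Rightarrow> mv33" where
  "contract a A =
     (\<chi> S. \<Sum>i\<in>- S. (-1) ^ card {j\<in>S. j < i} * form33 a (axis i 1) * (A $ insert i S))"

text \<open>
  Inner product of multivectors: \<open>(b1 \<and> ... \<and> br) \<cdot> C = b1 \<cdot> (... \<cdot> (br \<cdot> C))\<close>.
\<close>

definition inner33 :: "mv33 \<Rightarrow> mv33 \<Rightarrow> mv33" (infixr "\<cdot>" 76) where
  "A \<cdot> C = (\<Sum>S\<in>UNIV. (A $ S) *\<^sub>R
     foldr (\<lambda>i. contract (axis i 1)) (sorted_list_of_set S) C)"

text \<open>
  Clifford product on the exterior algebra.  A vector \<open>a\<close> acts by \<open>a A = a \<cdot> A + a \<and> A\<close>, and a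
  blade \<open>b1 \<and> ... \<and> br\<close> is the antisymmetrization
  \<open>(1 / r!) \<Sum>\<sigma>. sign \<sigma> b\<^bsub>\<sigma>1\<^esub> ... b\<^bsub>\<sigma>r\<^esub>\<close> of the Clifford product of its factors.
\<close>

definition vmult :: "R33 \<Rightarrow> mv33 \<Rightarrow> mv33" where
  "vmult a A = contract a A + vec1 a \<curlywedge> A"

definition clifford :: "mv33 \<Rightarrow> mv33 \<Rightarrow> mv33" where
  "clifford A B = (\<Sum>S\<in>UNIV. (A $ S / fact (card S)) *\<^sub>R
     (\<Sum>p | p permutes S. of_int (sign p) *\<^sub>R
        foldr (\<lambda>i. vmult (axis (p i) 1)) (sorted_list_of_set S) B))"

definition cross33 :: "R33 \<Rightarrow> R33 \<Rightarrow> R33" where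
  "cross33 X Y =
     (let x1 = (\<chi> i. X $ Inl i); y1 = (\<chi> i. X $ Inr i);
          x2 = (\<chi> i. Y $ Inl i); y2 = (\<chi> i. Y $ Inr i)
      in col (cross3 x1 x2) (cross3 x1 y2 + cross3 y1 x2))"


section \<open>The trivectors\<close>

definition J3 :: mv33 where "J3 = EI' 1 \<curlywedge> EI' 2 \<curlywedge> EI' 3"
definition I3 :: mv33 where "I3 = EI 1 \<curlywedge> EI 2 \<curlywedge> EI 3"
definition K2 :: mv33 where "K2 = EI 1 \<curlywedge> EI' 1 + EI 2 \<curlywedge> EI' 2 + EI 3 \<curlywedge> EI' 3"

text \<open>
  The basis \<open>e\<^sub>0, e\<^sub>1, e\<^sub>2, e\<^sub>3\<close> of \<open>real^4\<close> is indexed by \<open>0, 1, 2, 3\<close> (in the numeral type,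
  \<open>0 = 4\<close>).
\<close>

definition F :: "real ^ 4 \<Rightarrow> mv33" where
  "F p = (let x0 = p $ 0; Ex = vec1 (E (vector [p $ 1, p $ 2, p $ 3]))
          in Ex \<curlywedge> (Ex \<cdot> J3) - x0 *\<^sub>R (Ex \<curlywedge> K2) + x0\<^sup>2 *\<^sub>R I3)"

definition C3 :: mv33 where
  "C3 = F (axis 1 1) + F (axis 2 1) + F (axis 3 1)"

text \<open>\<open>EpEp\<close>, \<open>EltEp\<close>, \<open>EgtEp\<close> are the maps \<open>E'E'\<close>, \<open>E\<^sub><E'\<close>, \<open>E\<^sub>>E'\<close>.\<close>

definition EpEp :: "real ^ 3 \<Rightarrow> mv33" where
  "EpEp x = x $ 1 *\<^sub>R (EI' 2 \<curlywedge> EI' 3) + x $ 2 *\<^sub>R (EI' 3 \<curlywedge> EI' 1) + x $ 3 *\<^sub>R (EI' 1 \<curlywedge> EI' 2)"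

definition EltEp :: "real ^ 3 \<Rightarrow> mv33" where
  "EltEp x = x $ 1 *\<^sub>R (EI 2 \<curlywedge> EI' 3) + x $ 2 *\<^sub>R (EI 3 \<curlywedge> EI' 1) + x $ 3 *\<^sub>R (EI 1 \<curlywedge> EI' 2)"

definition EgtEp :: "real ^ 3 \<Rightarrow> mv33" where
  "EgtEp x = x $ 1 *\<^sub>R (EI 3 \<curlywedge> EI' 2) + x $ 2 *\<^sub>R (EI 1 \<curlywedge> EI' 3) + x $ 3 *\<^sub>R (EI 2 \<curlywedge> EI' 1)"


section \<open>Bivector forms and \<open>se(3)\<close>\<close>

definition e4 :: "4 \<Rightarrow> 4 multivector" where "e4 i = vec1 (axis i 1)"

text \<open>
  The identification of \<open>R33\<close> with \<open>grade 2\<close> of the exterior algebra of \<open>real^4\<close>: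
  \<open>E\<^sub>i = e\<^sub>0 \<and> e\<^sub>i\<close>, \<open>E\<^sub>1' = e\<^sub>2 \<and> e\<^sub>3\<close>, \<open>E\<^sub>2' = e\<^sub>3 \<and> e\<^sub>1\<close>, \<open>E\<^sub>3' = e\<^sub>1 \<and> e\<^sub>2\<close>.
\<close>

definition to_biv4 :: "R33 \<Rightarrow> 4 multivector" where
  "to_biv4 X =
     X $ Inl 1 *\<^sub>R (e4 0 \<curlywedge> e4 1) + X $ Inl 2 *\<^sub>R (e4 0 \<curlywedge> e4 2) + X $ Inl 3 *\<^sub>R (e4 0 \<curlywedge> e4 3)
   + X $ Inr 1 *\<^sub>R (e4 2 \<curlywedge> e4 3) + X $ Inr 2 *\<^sub>R (e4 3 \<curlywedge> e4 1) + X $ Inr 3 *\<^sub>R (e4 1 \<curlywedge> e4 2)"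

definition of_biv4 :: "4 multivector \<Rightarrow> R33" where
  "of_biv4 = inv to_biv4"

text \<open>
  The operator \<open>M \<otimes> I + I \<otimes> M\<close> on bivectors, given by its values on the basis \<open>e\<^sub>i \<and> e\<^sub>j\<close> with
  \<open>i < j\<close>; see \<open>tensor_action_wedge\<close> for its value on \<open>a \<and> b\<close>.
\<close>

definition tensor_action :: "real ^ 4 ^ 4 \<Rightarrow> 4 multivector \<Rightarrow> 4 multivector" where
  "tensor_action M A = (\<Sum>(i, j) | i < j. A $ {i, j} *\<^sub>R
     (vec1 (M *v axis i 1) \<curlywedge> e4 j + e4 i \<curlywedge> vec1 (M *v axis j 1)))"

definition sl4 :: "(real ^ 4 ^ 4) set" where
  "sl4 = {M. trace M = 0}"

definition is_bivector_form :: "real ^ 4 ^ 4 \<Rightarrow> mv33 \<Rightarrow> bool" where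
  "is_bivector_form M B \<longleftrightarrow> B \<in> grade 2 \<and>
     (\<forall>A \<in> grade 2. clifford B (vec1 (of_biv4 A)) - clifford (vec1 (of_biv4 A)) B =
        vec1 (of_biv4 (tensor_action M A)))"

definition bivector_form :: "real ^ 4 ^ 4 \<Rightarrow> mv33" where
  "bivector_form M = (THE B. is_bivector_form M B)"

text \<open>Entries in the index order \<open>0, 1, 2, 3\<close>.\<close>

definition tuple4 :: "'a \<Rightarrow> 'a \<Rightarrow> 'a \<Rightarrow> 'a \<Rightarrow> 'a ^ 4" where
  "tuple4 a b c d = (\<chi> i. if i = 0 then a else if i = 1 then b else if i = 2 then c else d)"

definition se3_matrix :: "real ^ 3 \<Rightarrow> real ^ 3 \<Rightarrow> real ^ 4 ^ 4" where
  "se3_matrix t v = tuple4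
     (tuple4 0       0         0         0)
     (tuple4 (t $ 1) 0         (- v $ 3) (v $ 2))
     (tuple4 (t $ 2) (v $ 3)   0         (- v $ 1))
     (tuple4 (t $ 3) (- v $ 2) (v $ 1)   0)"

definition se3 :: "(real ^ 4 ^ 4) set" where
  "se3 = {se3_matrix t v | t v. True}"


section \<open>The definitions on products of vectors\<close>

lemma vec1_nth: "vec1 a $ S = (\<Sum>i\<in>UNIV. if S = {i} then a $ i else 0)"
  by (simp add: vec1_def axis_def if_distrib cong: if_cong)

lemma vec1_singleton [simp]: "vec1 a $ {i} = a $ i"
  by (simp add: vec1_nth)

lemma vec1_eq_0: "card S \<noteq> 1 \<Longrightarrow> vec1 a $ S = 0"
  unfolding vec1_nth by (rule sum.neutral) auto

lemma vec1_wedge_nth: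
  fixes a :: "real ^ 'n::{finite,linorder}"
  shows "(vec1 a \<curlywedge> C) $ S = (\<Sum>i\<in>S. (-1) ^ card {j\<in>S. j < i} * a $ i * C $ (S - {i}))"
proof -
  have sg: "merge_sign {i} (S - {i}) = (-1) ^ card {j\<in>S. j < i}" for i
  proof -
    have "{(s, t). s \<in> {i} \<and> t \<in> S - {i} \<and> t < s} = Pair i ` {j\<in>S. j < i}"
      by auto
    then show ?thesis
      by (simp add: merge_sign_def card_image inj_on_def)
  qed
  have "(vec1 a \<curlywedge> C) $ S = (\<Sum>T\<in>(\<lambda>i. {i}) ` S. merge_sign T (S - T) * vec1 a $ T * C $ (S - T))"
    unfolding wedge_def vec_lambda_beta
  proof (rule sum.mono_neutral_right)
    show "\<forall>T\<in>Pow S - (\<lambda>i. {i}) ` S. merge_sign T (S - T) * vec1 a $ T * C $ (S - T) = 0"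
    proof
      fix T assume T: "T \<in> Pow S - (\<lambda>i. {i}) ` S"
      then have "card T \<noteq> 1" by (auto simp: card_1_singleton_iff)
      then show "merge_sign T (S - T) * vec1 a $ T * C $ (S - T) = 0"
        by (simp add: vec1_eq_0)
    qed
  qed auto
  also have "\<dots> = (\<Sum>i\<in>S. (-1) ^ card {j\<in>S. j < i} * a $ i * C $ (S - {i}))"
    by (subst sum.reindex) (auto simp: sg)
  finally show ?thesis .
qed

lemma wedge_add_left: "(A + B) \<curlywedge> C = A \<curlywedge> C + B \<curlywedge> C"
  by (simp add: wedge_def vec_eq_iff algebra_simps sum.distrib)

lemma wedge_add_right: "A \<curlywedge> (B + C) = A \<curlywedge> B + A \<curlywedge> C"
  by (simp add: wedge_def vec_eq_iff algebra_simps sum.distrib)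

lemma wedge_scaleR_left: "(c *\<^sub>R A) \<curlywedge> B = c *\<^sub>R (A \<curlywedge> B)"
  by (simp add: wedge_def vec_eq_iff sum_distrib_left algebra_simps)

lemma wedge_scaleR_right: "A \<curlywedge> (c *\<^sub>R B) = c *\<^sub>R (A \<curlywedge> B)"
  by (simp add: wedge_def vec_eq_iff sum_distrib_left algebra_simps)

lemma vec1_add: "vec1 (a + b) = vec1 a + vec1 b"
  by (simp add: vec1_def sum.distrib algebra_simps)

lemma vec1_scaleR: "vec1 (c *\<^sub>R a) = c *\<^sub>R vec1 a"
  by (simp add: vec1_def scaleR_sum_right)

lemma card_insert_less:
  fixes S :: "('n::{finite,linorder}) set"
  assumes "i \<notin> S" "i \<noteq> j"
  shows "card {k\<in>insert i S. k < j} = card {k\<in>S. k < j} + (if i < j then 1 else 0)"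
proof (cases "i < j")
  case True
  then have "{k\<in>insert i S. k < j} = insert i {k\<in>S. k < j}" by auto
  then show ?thesis using assms True by simp
next
  case False
  then have "{k\<in>insert i S. k < j} = {k\<in>S. k < j}" by auto
  then show ?thesis using False by simp
qed

lemma form33_axis_sum: "form33 a b = (\<Sum>i\<in>UNIV. form33 a (axis i 1) * b $ i)"
proof -
  have u: "(\<Sum>k\<in>UNIV. h k) = (\<Sum>i\<in>UNIV. h (Inl i)) + (\<Sum>i\<in>UNIV. h (Inr i))"
    for h :: "3 + 3 \<Rightarrow> real"
    by (subst UNIV_Plus_UNIV [symmetric], subst sum.Plus) (auto simp: o_def)
  have "form33 a (axis (Inl i) 1) = a $ Inr i" "form33 a (axis (Inr i) 1) = a $ Inl i" for i
  proof -
    have "form33 a (axis (Inl i) 1) = (\<Sum>j\<in>UNIV. if j = i then a $ Inr i else 0)"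
      unfolding form33_def by (intro sum.cong) (auto simp: axis_def)
    moreover have "form33 a (axis (Inr i) 1) = (\<Sum>j\<in>UNIV. if j = i then a $ Inl i else 0)"
      unfolding form33_def by (intro sum.cong) (auto simp: axis_def)
    ultimately show "form33 a (axis (Inl i) 1) = a $ Inr i" "form33 a (axis (Inr i) 1) = a $ Inl i"
      by simp_all
  qed
  then show ?thesis
    by (simp add: u form33_def [of a b] sum.distrib algebra_simps)
qed

text \<open>Contraction by a vector is an antiderivation.\<close>

lemma contract_vec1_wedge:
  "contract a (vec1 b \<curlywedge> C) = form33 a b *\<^sub>R C - vec1 b \<curlywedge> contract a C"
proof -
  let ?g = "\<lambda>i. form33 a (axis i 1)"
  let ?s = "\<lambda>S i. (-1::real) ^ card {k\<in>S. k < (i::3+3)}"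
  have "contract a (vec1 b \<curlywedge> C) $ S + (vec1 b \<curlywedge> contract a C) $ S = form33 a b * C $ S" for S
  proof -
    have cross: "?s S i * ?s (insert i S) j = - (?s S j * ?s (S - {j}) i)"
      if "i \<notin> S" "j \<in> S" for i j
    proof -
      have ij: "i \<noteq> j" using that by auto
      have 1: "card {k\<in>insert i S. k < j} = card {k\<in>S. k < j} + (if i < j then 1 else 0)"
        using card_insert_less that ij by blast
      have 2: "card {k\<in>insert j (S - {j}). k < i} = card {k\<in>S - {j}. k < i} + (if j < i then 1 else 0)"
        using card_insert_less [of j "S - {j}" i] ij by auto
      have 3: "insert j (S - {j}) = S" using that by auto
      show ?thesis using ij 2 unfolding 1 3 by (auto simp: neq_iff power_add)
    qed
    have "contract a (vec1 b \<curlywedge> C) $ S =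
        (\<Sum>i\<in>- S. \<Sum>j\<in>insert i S. ?s S i * ?s (insert i S) j * ?g i * b $ j * C $ (insert i S - {j}))"
      by (simp add: contract_def vec1_wedge_nth sum_distrib_left algebra_simps cong: sum.cong)
    also have "\<dots> = (\<Sum>i\<in>- S. ?g i * b $ i * C $ S +
        (\<Sum>j\<in>S. ?s S i * ?s (insert i S) j * ?g i * b $ j * C $ (insert i S - {j})))"
    proof (rule sum.cong [OF refl])
      fix i assume i: "i \<in> - S"
      have "{k\<in>insert i S. k < i} = {k\<in>S. k < i}" by auto
      then have "?s S i * ?s (insert i S) i = 1" by (simp flip: power_add mult_2)
      moreover have "insert i S - {i} = S" using i by auto
      ultimately show "(\<Sum>j\<in>insert i S. ?s S i * ?s (insert i S) j * ?g i * b $ j * C $ (insert i S - {j})) =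
          ?g i * b $ i * C $ S +
          (\<Sum>j\<in>S. ?s S i * ?s (insert i S) j * ?g i * b $ j * C $ (insert i S - {j}))"
        using i by (subst sum.insert) auto
    qed
    also have "\<dots> = (\<Sum>i\<in>- S. ?g i * b $ i * C $ S) -
        (\<Sum>j\<in>S. \<Sum>i\<in>- S. ?s S j * ?s (S - {j}) i * ?g i * b $ j * C $ (insert i S - {j}))"
    proof -
      have "(\<Sum>i\<in>- S. \<Sum>j\<in>S. ?s S i * ?s (insert i S) j * ?g i * b $ j * C $ (insert i S - {j})) =
         (\<Sum>i\<in>- S. \<Sum>j\<in>S. - (?s S j * ?s (S - {j}) i * ?g i * b $ j * C $ (insert i S - {j})))"
      proof (intro sum.cong refl)
        fix i j assume "i \<in> - S" "j \<in> S"
        then have "i \<notin> S" "j \<in> S" by auto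
        show "?s S i * ?s (insert i S) j * ?g i * b $ j * C $ (insert i S - {j}) =
            - (?s S j * ?s (S - {j}) i * ?g i * b $ j * C $ (insert i S - {j}))"
          unfolding cross [OF \<open>i \<notin> S\<close> \<open>j \<in> S\<close>] by simp
      qed
      also have "\<dots> = - (\<Sum>j\<in>S. \<Sum>i\<in>- S. ?s S j * ?s (S - {j}) i * ?g i * b $ j * C $ (insert i S - {j}))"
        by (subst sum.swap) (simp add: sum_negf)
      finally show ?thesis by (simp add: sum.distrib)
    qed
    finally have L: "contract a (vec1 b \<curlywedge> C) $ S = (\<Sum>i\<in>- S. ?g i * b $ i * C $ S) -
        (\<Sum>j\<in>S. \<Sum>i\<in>- S. ?s S j * ?s (S - {j}) i * ?g i * b $ j * C $ (insert i S - {j}))" .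
    have "(vec1 b \<curlywedge> contract a C) $ S =
        (\<Sum>j\<in>S. \<Sum>i\<in>- (S - {j}). ?s S j * ?s (S - {j}) i * ?g i * b $ j * C $ (insert i (S - {j})))"
      by (simp add: contract_def vec1_wedge_nth sum_distrib_left algebra_simps cong: sum.cong)
    also have "\<dots> = (\<Sum>j\<in>S. ?g j * b $ j * C $ S +
        (\<Sum>i\<in>- S. ?s S j * ?s (S - {j}) i * ?g i * b $ j * C $ (insert i S - {j})))"
    proof (rule sum.cong [OF refl])
      fix j assume j: "j \<in> S"
      have 0: "{k \<in> S. k \<noteq> j \<and> k < j} = {k\<in>S. k < j}" by auto
      have 1: "(-1::real) ^ n * (-1) ^ n = 1" for n :: nat by (simp flip: power_add mult_2)
      have 2: "insert j (S - {j}) = S" and 3: "- (S - {j}) = insert j (- S)" using j by auto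
      have 4: "insert i (S - {j}) = insert i S - {j}" if "i \<in> - S" for i using that j by auto
      show "(\<Sum>i\<in>- (S - {j}). ?s S j * ?s (S - {j}) i * ?g i * b $ j * C $ (insert i (S - {j}))) =
          ?g j * b $ j * C $ S +
          (\<Sum>i\<in>- S. ?s S j * ?s (S - {j}) i * ?g i * b $ j * C $ (insert i S - {j}))"
        unfolding 3 using j by (subst sum.insert) (auto simp: 0 1 2 4 simp del: insert_Diff_single)
    qed
    also have "\<dots> = (\<Sum>j\<in>S. ?g j * b $ j * C $ S) +
        (\<Sum>j\<in>S. \<Sum>i\<in>- S. ?s S j * ?s (S - {j}) i * ?g i * b $ j * C $ (insert i S - {j}))"
      by (simp add: sum.distrib)
    finally have R: "(vec1 b \<curlywedge> contract a C) $ S = (\<Sum>j\<in>S. ?g j * b $ j * C $ S) +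
        (\<Sum>j\<in>S. \<Sum>i\<in>- S. ?s S j * ?s (S - {j}) i * ?g i * b $ j * C $ (insert i S - {j}))" .
    have "form33 a b * C $ S = (\<Sum>i\<in>S \<union> - S. ?g i * b $ i * C $ S)"
      by (simp add: form33_axis_sum [of a b] sum_distrib_right)
    also have "\<dots> = (\<Sum>i\<in>S. ?g i * b $ i * C $ S) + (\<Sum>i\<in>- S. ?g i * b $ i * C $ S)"
      by (rule sum.union_disjoint) auto
    finally show ?thesis unfolding L R by simp
  qed
  then show ?thesis
    by (simp add: vec_eq_iff algebra_simps)
qed

definition wedge_list :: "(real ^ ('n::{finite,linorder})) list \<Rightarrow> 'n multivector" where
  "wedge_list bs = foldr (\<lambda>b A. vec1 b \<curlywedge> A) bs (scal 1)"

lemma wedge_sum_right: "A \<curlywedge> (\<Sum>i\<in>I. f i) = (\<Sum>i\<in>I. A \<curlywedge> f i)"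
proof (induction I rule: infinite_finite_induct)
  case (insert x I) then show ?case by (simp add: wedge_add_right)
qed (auto simp: wedge_def vec_eq_iff)

theorem contract_wedge_list:
  "contract a (wedge_list bs) =
     (\<Sum>i<length bs. ((-1) ^ i * form33 a (bs ! i)) *\<^sub>R wedge_list (take i bs @ drop (Suc i) bs))"
proof (induction bs)
  case Nil
  then show ?case by (simp add: wedge_list_def contract_def scal_def axis_def vec_eq_iff)
next
  case (Cons b bs)
  have c: "wedge_list (b # cs) = vec1 b \<curlywedge> wedge_list cs" for cs
    by (simp add: wedge_list_def)
  show ?case
    by (simp add: c contract_vec1_wedge Cons.IH wedge_sum_right wedge_scaleR_right
        sum.lessThan_Suc_shift sum_negf del: sum.lessThan_Suc)
qed


lemma vec1_wedge_swap: "vec1 a \<curlywedge> vec1 b \<curlywedge> C = - (vec1 b \<curlywedge> vec1 a \<curlywedge> C)"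
  for a b :: "real ^ 'n::{finite,linorder}"
proof -
  let ?s = "\<lambda>S i. (-1::real) ^ card {k\<in>S. k < i}"
  have "(vec1 a \<curlywedge> vec1 b \<curlywedge> C) $ S = - (vec1 b \<curlywedge> vec1 a \<curlywedge> C) $ S" for S
  proof -
    have expand: "(vec1 a \<curlywedge> vec1 b \<curlywedge> C) $ S =
        (\<Sum>i\<in>S. \<Sum>j\<in>S. if i = j then 0 else ?s S i * ?s (S - {i}) j * a $ i * b $ j * C $ (S - {i} - {j}))"
      for a b
    proof -
      have "(vec1 a \<curlywedge> vec1 b \<curlywedge> C) $ S =
        (\<Sum>i\<in>S. \<Sum>j\<in>S - {i}. ?s S i * ?s (S - {i}) j * a $ i * b $ j * C $ (S - {i} - {j}))"
        by (simp add: vec1_wedge_nth sum_distrib_left algebra_simps cong: sum.cong)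
      also have "\<dots> = (\<Sum>i\<in>S. \<Sum>j\<in>S. if i = j then 0 else ?s S i * ?s (S - {i}) j * a $ i * b $ j * C $ (S - {i} - {j}))"
        by (intro sum.cong refl sum.mono_neutral_cong_left) auto
      finally show ?thesis .
    qed
    have key: "?s S i * ?s (S - {i}) j = - (?s S j * ?s (S - {j}) i)"
      if "i \<in> S" "j \<in> S" "i \<noteq> j" for i j
    proof -
      have 1: "card {k\<in>insert i (S - {i}). k < j} = card {k\<in>S - {i}. k < j} + (if i < j then 1 else 0)"
        using card_insert_less [of i "S - {i}" j] that by auto
      have 2: "card {k\<in>insert j (S - {j}). k < i} = card {k\<in>S - {j}. k < i} + (if j < i then 1 else 0)"
        using card_insert_less [of j "S - {j}" i] that by auto
      have 3: "insert i (S - {i}) = S" "insert j (S - {j}) = S" using that by auto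
      show ?thesis using that 1 2 unfolding 3 by (auto simp: neq_iff power_add)
    qed
    have "(\<Sum>i\<in>S. \<Sum>j\<in>S. if i = j then 0 else ?s S i * ?s (S - {i}) j * a $ i * b $ j * C $ (S - {i} - {j})) =
      (\<Sum>i\<in>S. \<Sum>j\<in>S. - (if j = i then 0 else ?s S j * ?s (S - {j}) i * b $ j * a $ i * C $ (S - {j} - {i})))"
    proof (intro sum.cong refl)
      fix i j assume ij: "i \<in> S" "j \<in> S"
      have eq: "S - {i} - {j} = S - {j} - {i}" by auto
      show "(if i = j then 0 else ?s S i * ?s (S - {i}) j * a $ i * b $ j * C $ (S - {i} - {j})) =
          - (if j = i then 0 else ?s S j * ?s (S - {j}) i * b $ j * a $ i * C $ (S - {j} - {i}))"
      proof (cases "i = j")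
        case False
        then show ?thesis
          unfolding key [OF ij False] unfolding eq by (simp add: mult_ac)
      qed simp
    qed
    also have "\<dots> = - (\<Sum>j\<in>S. \<Sum>i\<in>S. if j = i then 0 else ?s S j * ?s (S - {j}) i * b $ j * a $ i * C $ (S - {j} - {i}))"
      by (subst sum.swap) (simp add: sum_negf)
    finally show ?thesis by (simp add: expand)
  qed
  then show ?thesis by (simp add: vec_eq_iff)
qed

lemma wedge_scal_1: "A \<curlywedge> scal 1 = A"
proof -
  have "(A \<curlywedge> scal 1) $ S = A $ S" for S
  proof -
    have "(A \<curlywedge> scal 1) $ S = (\<Sum>T\<in>{S}. merge_sign T (S - T) * (A $ T) * (scal 1 $ (S - T)))"
      unfolding wedge_def vec_lambda_beta
      by (rule sum.mono_neutral_right) (auto simp: scal_def axis_def)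
    then show ?thesis by (simp add: scal_def axis_def merge_sign_def)
  qed
  then show ?thesis by (simp add: vec_eq_iff)
qed

lemma vec1_wedge_anticommute: "vec1 a \<curlywedge> vec1 b = - (vec1 b \<curlywedge> vec1 a)"
  using vec1_wedge_swap [of a b "scal 1"] by (simp add: wedge_scal_1)

lemma contract_swap: "contract a (contract b C) = - contract b (contract a C)"
proof -
  let ?s = "\<lambda>S i. (-1::real) ^ card {k\<in>S. k < (i::3+3)}"
  let ?g = "\<lambda>a i. form33 a (axis i 1)"
  have "contract a (contract b C) $ S = - contract b (contract a C) $ S" for S
  proof -
    have expand: "contract a (contract b C) $ S =
        (\<Sum>i\<in>-S. \<Sum>j\<in>-S. if i = j then 0 else ?s S i * ?s (insert i S) j * ?g a i * ?g b j * C $ (insert j (insert i S)))"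
      for a b
    proof -
      have "contract a (contract b C) $ S =
        (\<Sum>i\<in>-S. \<Sum>j\<in>- insert i S. ?s S i * ?s (insert i S) j * ?g a i * ?g b j * C $ (insert j (insert i S)))"
        by (simp add: contract_def sum_distrib_left algebra_simps cong: sum.cong)
      also have "\<dots> = (\<Sum>i\<in>-S. \<Sum>j\<in>-S. if i = j then 0 else ?s S i * ?s (insert i S) j * ?g a i * ?g b j * C $ (insert j (insert i S)))"
        by (intro sum.cong refl sum.mono_neutral_cong_left) auto
      finally show ?thesis .
    qed
    have key: "?s S i * ?s (insert i S) j = - (?s S j * ?s (insert j S) i)"
      if "i \<notin> S" "j \<notin> S" "i \<noteq> j" for i j
    proof -
      have 1: "card {k\<in>insert i S. k < j} = card {k\<in>S. k < j} + (if i < j then 1 else 0)"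
        using card_insert_less that by blast
      have 2: "card {k\<in>insert j S. k < i} = card {k\<in>S. k < i} + (if j < i then 1 else 0)"
        using card_insert_less [of j S i] that by auto
      show ?thesis using that unfolding 1 2 by (auto simp: neq_iff power_add)
    qed
    have "(\<Sum>i\<in>-S. \<Sum>j\<in>-S. if i = j then 0 else ?s S i * ?s (insert i S) j * ?g a i * ?g b j * C $ (insert j (insert i S))) =
      (\<Sum>i\<in>-S. \<Sum>j\<in>-S. - (if j = i then 0 else ?s S j * ?s (insert j S) i * ?g b j * ?g a i * C $ (insert i (insert j S))))"
    proof (intro sum.cong refl)
      fix i j assume "i \<in> - S" "j \<in> - S"
      then have ij: "i \<notin> S" "j \<notin> S" by auto
      have eq: "insert j (insert i S) = insert i (insert j S)" by auto
      show "(if i = j then 0 else ?s S i * ?s (insert i S) j * ?g a i * ?g b j * C $ (insert j (insert i S))) =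
          - (if j = i then 0 else ?s S j * ?s (insert j S) i * ?g b j * ?g a i * C $ (insert i (insert j S)))"
      proof (cases "i = j")
        case False
        then show ?thesis
          unfolding key [OF ij False] unfolding eq by (simp add: mult_ac)
      qed simp
    qed
    also have "\<dots> = - (\<Sum>j\<in>-S. \<Sum>i\<in>-S. if j = i then 0 else ?s S j * ?s (insert j S) i * ?g b j * ?g a i * C $ (insert i (insert j S)))"
      by (subst sum.swap) (simp add: sum_negf)
    finally show ?thesis by (simp add: expand)
  qed
  then show ?thesis by (simp add: vec_eq_iff)
qed

lemma sum_pairs:
  fixes G :: "'n::{finite,linorder} \<Rightarrow> 'n \<Rightarrow> 'b::real_vector"
  assumes "\<And>i j. G j i = - G i j"
  shows "(\<Sum>(i, j) | i < j. (a i * b j - a j * b i) *\<^sub>R G i j) = (\<Sum>i\<in>UNIV. \<Sum>j\<in>UNIV. (a i * b j) *\<^sub>R G i j)"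
proof -
  let ?f = "\<lambda>(i, j). (a i * b j) *\<^sub>R G i j"
  have diag: "G i i = 0" for i
    using assms [of i i] by (simp add: eq_neg_iff_add_eq_0 flip: scaleR_2)
  have "(\<Sum>i\<in>UNIV. \<Sum>j\<in>UNIV. (a i * b j) *\<^sub>R G i j) = sum ?f UNIV"
    by (simp add: sum.cartesian_product)
  also have "\<dots> = sum ?f ({(i, j). i < j} \<union> {(i, j). j < i})"
  proof (rule sum.mono_neutral_right)
    show "\<forall>p\<in>UNIV - ({(i, j). i < j} \<union> {(i, j). j < i}). ?f p = 0"
    proof
      fix p assume "p \<in> UNIV - ({(i, j). i < j} \<union> {(i::'n, j). j < i})"
      then have "fst p = snd p" by (auto simp: not_less)
      then show "?f p = 0" by (simp add: diag case_prod_beta)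
    qed
  qed auto
  also have "\<dots> = sum ?f {(i, j). i < j} + sum ?f {(i, j). j < i}"
    by (rule sum.union_disjoint) auto
  also have "sum ?f {(i, j). j < i} = (\<Sum>(i, j) | i < j. (a j * b i) *\<^sub>R G j i)"
    by (rule sum.reindex_bij_witness [of _ "\<lambda>(i, j). (j, i)" "\<lambda>(i, j). (j, i)"]) auto
  also have "\<dots> = (\<Sum>(i, j) | i < j. - ((a j * b i) *\<^sub>R G i j))"
  proof (intro sum.cong refl, clarify)
    fix i j show "(a j * b i) *\<^sub>R G j i = - ((a j * b i) *\<^sub>R G i j)"
      using assms [of j i] by simp
  qed
  finally show ?thesis
    unfolding sum.distrib [symmetric]
    by (simp add: case_prod_beta scaleR_left_diff_distrib)
qed

lemma wedge2_nth: "i < j \<Longrightarrow> (vec1 a \<curlywedge> vec1 b) $ {i, j} = a $ i * b $ j - a $ j * b $ i"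
proof -
  assume ij: "i < j"
  then have "{k. (k = i \<or> k = j) \<and> k < i} = {}" "{k. (k = i \<or> k = j) \<and> k < j} = {i}"
    "{i, j} - {i} = {j}" "{i, j} - {j} = {i}" "i \<noteq> j"
    by auto
  note this [simp]
  show ?thesis by (simp add: vec1_wedge_nth)
qed

lemma wedge2_eq_0: "card S \<noteq> 2 \<Longrightarrow> (vec1 a \<curlywedge> vec1 b) $ S = 0"
  unfolding vec1_wedge_nth
proof (rule sum.neutral, rule ballI)
  fix i assume "card S \<noteq> 2" "i \<in> S"
  then have "card (S - {i}) \<noteq> 1" by (auto simp: card_Diff_singleton_if)
  then show "(- 1) ^ card {j \<in> S. j < i} * a $ i * vec1 b $ (S - {i}) = 0"
    by (simp add: vec1_eq_0)
qed

lemma sum_wedge2: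
  fixes H :: "('n::{finite,linorder}) set \<Rightarrow> 'b::real_vector"
  shows "(\<Sum>S\<in>UNIV. (vec1 a \<curlywedge> vec1 b) $ S *\<^sub>R H S) =
     (\<Sum>(i, j) | i < j. (a $ i * b $ j - a $ j * b $ i) *\<^sub>R H {i, j})"
proof -
  have c2: "S \<in> (\<lambda>(i, j). {i, j}) ` {(i, j). i < j}" if c: "card S = 2" for S :: "'n set"
  proof -
    obtain x y where S: "S = {x, y}" and "x \<noteq> y" using c unfolding card_2_iff by blast
    then consider "x < y" | "y < x" by fastforce
    then show ?thesis
    proof cases
      case 1 then show ?thesis using S by (intro image_eqI [of _ _ "(x, y)"]) auto
    next
      case 2 then show ?thesis using S by (intro image_eqI [of _ _ "(y, x)"]) auto
    qed
  qed
  have "(\<Sum>S\<in>UNIV. (vec1 a \<curlywedge> vec1 b) $ S *\<^sub>R H S) =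
     (\<Sum>S\<in>(\<lambda>(i, j). {i, j}) ` {(i, j). i < j}. (vec1 a \<curlywedge> vec1 b) $ S *\<^sub>R H S)"
  proof (rule sum.mono_neutral_right)
    show "\<forall>S\<in>UNIV - (\<lambda>(i, j). {i, j}) ` {(i, j). i < j}. (vec1 a \<curlywedge> vec1 b) $ S *\<^sub>R H S = 0"
    proof
      fix S :: "'n set" assume "S \<in> UNIV - (\<lambda>(i, j). {i, j}) ` {(i, j). i < j}"
      then have "card S \<noteq> 2" using c2 by blast
      then show "(vec1 a \<curlywedge> vec1 b) $ S *\<^sub>R H S = 0" by (simp add: wedge2_eq_0)
    qed
  qed auto
  also have "\<dots> = (\<Sum>(i, j) | i < j. (vec1 a \<curlywedge> vec1 b) $ {i, j} *\<^sub>R H {i, j})"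
  proof (subst sum.reindex)
    show "inj_on (\<lambda>(i, j). {i, j}) {(i::'n, j). i < j}"
      by (auto simp: inj_on_def doubleton_eq_iff)
  qed (auto intro: sum.cong)
  finally show ?thesis
    by (auto simp: wedge2_nth intro: sum.cong)
qed

lemma vec1_wedge_axis: "vec1 a \<curlywedge> C = (\<Sum>i\<in>UNIV. a $ i *\<^sub>R (vec1 (axis i 1) \<curlywedge> C))"
proof -
  have "(vec1 a \<curlywedge> C) $ S = (\<Sum>i\<in>UNIV. a $ i *\<^sub>R (vec1 (axis i 1) \<curlywedge> C)) $ S" for S
  proof -
    have "(vec1 (axis i 1) \<curlywedge> C) $ S = (if i \<in> S then (-1) ^ card {j\<in>S. j < i} * C $ (S - {i}) else 0)" for i
      by (simp add: vec1_wedge_nth axis_def if_distrib if_distribR sum.delta cong: if_cong)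
    then show ?thesis
      unfolding vec1_wedge_nth [of a] sum_component vector_scaleR_component
      by (intro sum.mono_neutral_cong_left) auto
  qed
  then show ?thesis by (simp add: vec_eq_iff)
qed

lemma contract_axis: "contract a C = (\<Sum>i\<in>UNIV. a $ i *\<^sub>R contract (axis i 1) C)"
proof -
  have sym: "form33 a b = form33 b a" for a b
    by (simp add: form33_def algebra_simps)
  have "form33 a b = (\<Sum>i\<in>UNIV. a $ i * form33 (axis i 1) b)" for b
    using form33_axis_sum [of b a] sym by (simp add: algebra_simps)
  then show ?thesis
    unfolding vec_eq_iff contract_def
    by (auto simp: sum_distrib_left sum_distrib_right algebra_simps intro: sum.swap)
qed

lemma contract_scaleR: "contract a (c *\<^sub>R C) = c *\<^sub>R contract a C"
  by (simp add: contract_def vec_eq_iff sum_distrib_left algebra_simps)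

lemma contract_add: "contract a (B + C) = contract a B + contract a C"
  by (simp add: contract_def vec_eq_iff sum.distrib algebra_simps)

lemma contract_sum: "contract a (\<Sum>i\<in>I. f i) = (\<Sum>i\<in>I. contract a (f i))"
proof (induction I rule: infinite_finite_induct)
  case (insert x I) then show ?case by (simp add: contract_add)
qed (auto simp: contract_def vec_eq_iff)

lemma sum_vec1:
  fixes H :: "('n::finite) set \<Rightarrow> 'b::real_vector"
  shows "(\<Sum>S\<in>UNIV. vec1 a $ S *\<^sub>R H S) = (\<Sum>i\<in>UNIV. a $ i *\<^sub>R H {i})"
proof -
  have "(\<Sum>S\<in>UNIV. vec1 a $ S *\<^sub>R H S) = (\<Sum>S\<in>range (\<lambda>i. {i}). vec1 a $ S *\<^sub>R H S)"
    by (rule sum.mono_neutral_right) (auto simp: vec1_nth intro!: sum.neutral)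
  then show ?thesis by (simp add: sum.reindex)
qed

theorem inner33_vec1: "vec1 a \<cdot> C = contract a C"
  by (simp add: inner33_def sum_vec1 flip: contract_axis)

theorem inner33_wedge: "(vec1 a \<curlywedge> vec1 b) \<cdot> C = vec1 a \<cdot> vec1 b \<cdot> C"
proof -
  have "(vec1 a \<curlywedge> vec1 b) \<cdot> C = (\<Sum>(i, j) | i < j. (a $ i * b $ j - a $ j * b $ i) *\<^sub>R
       contract (axis i 1) (contract (axis j 1) C))"
    unfolding inner33_def sum_wedge2
  proof (intro sum.cong refl, clarify)
    fix i j :: "3 + 3" assume "i < j"
    then have "insort i [j] = [i, j]" "j \<notin> {i}" "i \<notin> {j}" by auto
    then have "sorted_list_of_set {i, j} = [i, j]" by simp
    then show "(a $ i * b $ j - a $ j * b $ i) *\<^sub>R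
         foldr (\<lambda>i. contract (axis i 1)) (sorted_list_of_set {i, j}) C =
         (a $ i * b $ j - a $ j * b $ i) *\<^sub>R contract (axis i 1) (contract (axis j 1) C)"
      by simp
  qed
  also have "\<dots> = (\<Sum>i\<in>UNIV. \<Sum>j\<in>UNIV. (a $ i * b $ j) *\<^sub>R contract (axis i 1) (contract (axis j 1) C))"
    by (rule sum_pairs) (rule contract_swap)
  also have "\<dots> = contract a (contract b C)"
    unfolding contract_axis [of a "contract b C"] unfolding contract_axis [of b C]
    by (simp add: contract_sum contract_scaleR scaleR_sum_right)
  finally show ?thesis by (simp add: inner33_vec1)
qed

theorem vmult_vmult: "vmult a (vmult a C) = form33 a a *\<^sub>R C"
proof -
  have "vec1 a \<curlywedge> vec1 a \<curlywedge> C = 0" "contract a (contract a C) = 0"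
    using vec1_wedge_swap [of a a C] contract_swap [of a a C]
    by (simp_all add: eq_neg_iff_add_eq_0 flip: scaleR_2)
  then show ?thesis
    by (simp add: vmult_def contract_add wedge_add_right contract_vec1_wedge)
qed

lemma vmult_axis: "vmult a C = (\<Sum>i\<in>UNIV. a $ i *\<^sub>R vmult (axis i 1) C)"
  using contract_axis [of a C] vec1_wedge_axis [of a C]
  by (simp add: vmult_def sum.distrib scaleR_add_right)

theorem clifford_vec1: "clifford (vec1 a) C = vmult a C"
proof -
  have "clifford (vec1 a) C = (\<Sum>S\<in>UNIV. vec1 a $ S *\<^sub>R ((1 / fact (card S)) *\<^sub>R
     (\<Sum>p | p permutes S. of_int (sign p) *\<^sub>R
        foldr (\<lambda>i. vmult (axis (p i) 1)) (sorted_list_of_set S) C)))"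
    by (simp add: clifford_def)
  then show ?thesis
    unfolding sum_vec1 by (simp flip: vmult_axis)
qed

theorem clifford_wedge:
  "clifford (vec1 a \<curlywedge> vec1 b) C = (1 / 2) *\<^sub>R (vmult a (vmult b C) - vmult b (vmult a C))"
proof -
  let ?v = "\<lambda>i. vmult (axis i 1)"
  let ?G = "\<lambda>i j. (1 / 2) *\<^sub>R (?v i (?v j C) - ?v j (?v i C))"
  have lin: "vmult x (c *\<^sub>R A) = c *\<^sub>R vmult x A" for x c A
    by (simp add: vmult_def contract_scaleR wedge_scaleR_right scaleR_add_right)
  have sum: "vmult x (\<Sum>i\<in>UNIV. f i) = (\<Sum>i\<in>UNIV. vmult x (f i))" for x and f :: "3 + 3 \<Rightarrow> mv33"
    by (simp add: vmult_def contract_sum wedge_sum_right sum.distrib)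
  have ex: "vmult x (vmult y C) = (\<Sum>i\<in>UNIV. \<Sum>j\<in>UNIV. (x $ i * y $ j) *\<^sub>R ?v i (?v j C))" for x y
    unfolding vmult_axis [of x "vmult y C"] unfolding vmult_axis [of y C]
    by (simp add: sum lin scaleR_sum_right)
  have "clifford (vec1 a \<curlywedge> vec1 b) C = (\<Sum>S\<in>UNIV. (vec1 a \<curlywedge> vec1 b) $ S *\<^sub>R
     ((1 / fact (card S)) *\<^sub>R (\<Sum>p | p permutes S. of_int (sign p) *\<^sub>R
        foldr (\<lambda>i. vmult (axis (p i) 1)) (sorted_list_of_set S) C)))"
    by (simp add: clifford_def)
  also have "\<dots> = (\<Sum>(i, j) | i < j. (a $ i * b $ j - a $ j * b $ i) *\<^sub>R ?G i j)"
    unfolding sum_wedge2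
  proof (intro sum.cong refl, clarify)
    fix i j :: "3 + 3" assume ij: "i < j"
    then have "sorted_list_of_set {i, j} = [i, j]" "card {i, j} = 2" by auto
    moreover have "{p. p permutes {i, j}} = {id, Transposition.transpose i j}"
      by (auto simp: permutes_doubleton_iff)
    moreover have "id \<noteq> Transposition.transpose i j"
      using ij by (metis id_apply less_irrefl transpose_apply_first)
    ultimately show "(a $ i * b $ j - a $ j * b $ i) *\<^sub>R
         ((1 / fact (card {i, j})) *\<^sub>R (\<Sum>p | p permutes {i, j}. of_int (sign p) *\<^sub>R
        foldr (\<lambda>i. vmult (axis (p i) 1)) (sorted_list_of_set {i, j}) C)) =
        (a $ i * b $ j - a $ j * b $ i) *\<^sub>R ?G i j"
      using ij by (simp add: sign_swap_id)
  qed
  also have "\<dots> = (\<Sum>i\<in>UNIV. \<Sum>j\<in>UNIV. (a $ i * b $ j) *\<^sub>R ?G i j)"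
    by (rule sum_pairs) (simp add: scaleR_diff_right)
  also have "\<dots> = (1 / 2) *\<^sub>R ((\<Sum>i\<in>UNIV. \<Sum>j\<in>UNIV. (a $ i * b $ j) *\<^sub>R ?v i (?v j C)) -
      (\<Sum>i\<in>UNIV. \<Sum>j\<in>UNIV. (a $ i * b $ j) *\<^sub>R ?v j (?v i C)))"
    by (simp add: scaleR_diff_right scaleR_sum_right sum_subtractf mult.commute)
  also have "(\<Sum>i\<in>UNIV. \<Sum>j\<in>UNIV. (a $ i * b $ j) *\<^sub>R ?v j (?v i C)) = vmult b (vmult a C)"
    by (subst sum.swap) (simp only: ex [of b a] mult.commute)
  finally show ?thesis
    by (simp only: ex [of a b])
qed

theorem tensor_action_wedge:
  "tensor_action M (vec1 a \<curlywedge> vec1 b) = vec1 (M *v a) \<curlywedge> vec1 b + vec1 a \<curlywedge> vec1 (M *v b)"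
proof -
  let ?G = "\<lambda>i j. vec1 (M *v axis i 1) \<curlywedge> e4 j + e4 i \<curlywedge> vec1 (M *v axis j 1)"
  have anti: "?G j i = - ?G i j" for i j
    using vec1_wedge_anticommute [of "M *v axis j 1" "axis i 1"]
      vec1_wedge_anticommute [of "axis j 1" "M *v axis i 1"] by (simp add: e4_def)
  have lin: "linear (\<lambda>a. vec1 (M *v a) \<curlywedge> B)" "linear (\<lambda>a. vec1 a \<curlywedge> B)"
    "linear (\<lambda>a. B \<curlywedge> vec1 (M *v a))" "linear (\<lambda>a. B \<curlywedge> vec1 a)" for B
    by (auto intro!: linearI simp: matrix_vector_right_distrib matrix_vector_mult_scaleR vec1_add
        vec1_scaleR wedge_add_left wedge_add_right wedge_scaleR_left wedge_scaleR_right)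
  have ex: "f v = (\<Sum>i\<in>UNIV. v $ i *\<^sub>R f (axis i 1))" if "linear f" for f :: "real^4 \<Rightarrow> 4 multivector" and v
  proof -
    have "v = (\<Sum>i\<in>UNIV. v $ i *\<^sub>R axis i 1)"
      by (simp add: vec_eq_iff axis_def if_distrib cong: if_cong)
    then have "f v = f (\<Sum>i\<in>UNIV. v $ i *\<^sub>R axis i 1)" by simp
    also have "\<dots> = (\<Sum>i\<in>UNIV. v $ i *\<^sub>R f (axis i 1))"
      using that by (simp add: linear_sum linear_cmul)
    finally show ?thesis .
  qed
  have ex1: "vec1 (M *v v) \<curlywedge> B = (\<Sum>i\<in>UNIV. v $ i *\<^sub>R (vec1 (M *v axis i 1) \<curlywedge> B))" for v B
    by (rule ex [OF lin(1)])
  have ex2: "vec1 v \<curlywedge> B = (\<Sum>i\<in>UNIV. v $ i *\<^sub>R (vec1 (axis i 1) \<curlywedge> B))" for v and B :: "4 multivector"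
    by (rule ex [OF lin(2)])
  have ex3: "B \<curlywedge> vec1 (M *v v) = (\<Sum>i\<in>UNIV. v $ i *\<^sub>R (B \<curlywedge> vec1 (M *v axis i 1)))" for v B
    by (rule ex [OF lin(3)])
  have ex4: "B \<curlywedge> vec1 v = (\<Sum>i\<in>UNIV. v $ i *\<^sub>R (B \<curlywedge> vec1 (axis i 1)))" for v and B :: "4 multivector"
    by (rule ex [OF lin(4)])
  have "tensor_action M (vec1 a \<curlywedge> vec1 b) =
      (\<Sum>(i, j) | i < j. (a $ i * b $ j - a $ j * b $ i) *\<^sub>R ?G i j)"
    unfolding tensor_action_def by (rule sum.cong) (auto simp: wedge2_nth)
  also have "\<dots> = (\<Sum>i\<in>UNIV. \<Sum>j\<in>UNIV. (a $ i * b $ j) *\<^sub>R ?G i j)"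
    by (rule sum_pairs) (rule anti)
  also have "\<dots> = (\<Sum>i\<in>UNIV. a $ i *\<^sub>R (vec1 (M *v axis i 1) \<curlywedge> vec1 b)) +
      (\<Sum>i\<in>UNIV. a $ i *\<^sub>R (e4 i \<curlywedge> vec1 (M *v b)))"
    by (simp add: ex3 [of _ b] ex4 [of _ b] e4_def scaleR_sum_right sum.distrib scaleR_add_right)
  also have "\<dots> = vec1 (M *v a) \<curlywedge> vec1 b + vec1 a \<curlywedge> vec1 (M *v b)"
    by (simp add: e4_def ex1 [of a] ex2 [of a])
  finally show ?thesis .
qed

lemma less4: "(0::4) < 1" "(0::4) < 2" "(0::4) < 3" "(1::4) < 2" "(1::4) < 3" "(2::4) < 3"
proof -
  have "Rep_bit0 (0::4) = 0" "Rep_bit0 (1::4) = 1" "Rep_bit0 (2::4) = 2" "Rep_bit0 (3::4) = 3"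
    using bit0.Rep_0 [where 'a = "num1 bit0"] bit0.Rep_1 [where 'a = "num1 bit0"]
      bit0.Rep_numeral [where 'a = "num1 bit0" and w = "num.Bit0 num.One"]
      bit0.Rep_numeral [where 'a = "num1 bit0" and w = "num.Bit1 num.One"]
    by simp_all
  note rep = this
  show "(0::4) < 1" "(0::4) < 2" "(0::4) < 3" "(1::4) < 2" "(1::4) < 3" "(2::4) < 3"
    by (simp_all only: less_bit0_def rep)
qed

lemma UNIV_4': "(UNIV :: 4 set) = {0, 1, 2, 3}"
proof -
  have e: "(4::4) = 0" by simp
  show ?thesis unfolding UNIV_4 e by blast
qed

lemma axis_component: "axis k c $ i = (if i = k then c else 0)"
  by (simp add: axis_def)

lemma to_biv4_nth:
  "to_biv4 X $ {0, 1} = X $ Inl 1" "to_biv4 X $ {0, 2} = X $ Inl 2" "to_biv4 X $ {0, 3} = X $ Inl 3"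
  "to_biv4 X $ {2, 3} = X $ Inr 1" "to_biv4 X $ {1, 3} = - X $ Inr 2" "to_biv4 X $ {1, 2} = X $ Inr 3"
  unfolding to_biv4_def e4_def vector_add_component vector_scaleR_component
    less4 [THEN wedge2_nth] axis_component
  by simp_all

theorem bij_betw_to_biv4: "bij_betw to_biv4 UNIV (grade 2)"
proof (rule bij_betwI')
  have all6: "(\<forall>k. P k) \<longleftrightarrow> P (Inl 1) \<and> P (Inl 2) \<and> P (Inl 3) \<and> P (Inr 1) \<and> P (Inr 2) \<and> P (Inr 3)"
    for P :: "3 + 3 \<Rightarrow> bool"
    by (simp add: split_sum_all forall_3)
  show "to_biv4 X = to_biv4 Y \<longleftrightarrow> X = Y" for X Y
  proof
    assume "to_biv4 X = to_biv4 Y"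
    then have "to_biv4 X $ S = to_biv4 Y $ S" for S by simp
    note this [of "{0, 1}"] this [of "{0, 2}"] this [of "{0, 3}"]
      this [of "{2, 3}"] this [of "{1, 3}"] this [of "{1, 2}"]
    then show "X = Y" by (simp add: to_biv4_nth vec_eq_iff all6)
  qed simp
  show gr: "to_biv4 X \<in> grade 2" for X
    by (auto simp: grade_def to_biv4_def e4_def wedge2_eq_0)
  fix A :: "4 multivector" assume A: "A \<in> grade 2"
  define X :: R33 where "X = (\<chi> k. case k of
      Inl i \<Rightarrow> A $ {0, if i = 1 then 1 else if i = 2 then 2 else 3}
    | Inr i \<Rightarrow> if i = 1 then A $ {2, 3} else if i = 2 then - A $ {1, 3} else A $ {1, 2})"
  have "to_biv4 X $ S = A $ S" for S
  proof (cases "card S = 2")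
    case False
    then show ?thesis using A gr [of X] by (simp add: grade_def)
  next
    case True
    then obtain x y where S: "S = {x, y}" "x \<noteq> y" unfolding card_2_iff by blast
    have "x \<in> {0, 1, 2, 3}" "y \<in> {0, 1, 2, 3}" using UNIV_4' by auto
    then consider "S = {0, 1}" | "S = {0, 2}" | "S = {0, 3}" | "S = {1, 2}" | "S = {1, 3}" | "S = {2, 3}"
      using S by (auto simp: insert_commute)
    then show ?thesis by cases (simp_all add: to_biv4_nth X_def)
  qed
  then have "A = to_biv4 X" by (simp add: vec_eq_iff)
  then show "\<exists>X\<in>UNIV. A = to_biv4 X" by blast
qed

theorem of_biv4_to_biv4: "of_biv4 (to_biv4 X) = X"
  unfolding of_biv4_def
  using bij_betw_to_biv4 by (simp add: bij_betw_def)

theorem se3_subset_sl4: "se3 \<subseteq> sl4"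
  by (auto simp: se3_def sl4_def se3_matrix_def tuple4_def trace_def sum_4)

theorem se3_matrix_mult:
  "se3_matrix t v *v tuple4 p0 (p $ 1) (p $ 2) (p $ 3) =
     (let q = p0 *\<^sub>R t + cross3 v p in tuple4 0 (q $ 1) (q $ 2) (q $ 3))"
  by (simp add: vec_eq_iff matrix_vector_mult_def se3_matrix_def tuple4_def sum_4 forall_4 Let_def
      cross_components algebra_simps)

end

theory Submission
  imports Defs
begin

text \<open>
  For a bivector \<open>B\<close> and a vector \<open>z\<close> the Clifford commutator is \<open>Bz - zB = -2 z \<cdot> B\<close>, so
  nondegeneracy of the form makes bivector forms unique.  For \<open>B = X \<cdot> C3\<close> with
  \<open>X = (x, y)\<close> the commutator is \<open>-2 (z \<and> X) \<cdot> C3 = 2 z \<times> X\<close>, while the matrix in \<open>se(3)\<close> with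
  translation \<open>t\<close> and rotation \<open>v\<close> acts on bivectors of \<open>real^4\<close> as \<open>z \<mapsto> (v, t) \<times> z\<close>.  Hence
  \<open>X \<cdot> C3\<close> is the bivector form of the matrix with \<open>t = -2y\<close> and \<open>v = -2x\<close>.
\<close>

section \<open>Grades and basis expansion of bivectors\<close>

lemma vec1_wedge_grade: "C \<in> grade k \<Longrightarrow> vec1 a \<curlywedge> C \<in> grade (Suc k)"
proof -
  assume C: "C \<in> grade k"
  have "C $ (S - {i}) = 0" if "i \<in> S" "card S \<noteq> Suc k" for i S
  proof -
    have "card S = Suc (card (S - {i}))" using that by (intro card.remove) auto
    then show ?thesis using C that(2) by (simp add: grade_def)
  qed
  then show ?thesis by (auto simp: grade_def vec1_wedge_nth intro!: sum.neutral)
qed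

lemma wedge2_grade: "vec1 a \<curlywedge> vec1 b \<in> grade 2"
  by (simp add: grade_def wedge2_eq_0)

lemma grade_add: "A \<in> grade k \<Longrightarrow> B \<in> grade k \<Longrightarrow> A + B \<in> grade k"
  and grade_diff: "A \<in> grade k \<Longrightarrow> B \<in> grade k \<Longrightarrow> A - B \<in> grade k"
  and grade_scaleR: "A \<in> grade k \<Longrightarrow> c *\<^sub>R A \<in> grade k"
  by (auto simp: grade_def)

lemma grade2_eqI:
  assumes "A \<in> grade 2" "B \<in> grade 2" "\<And>i j. i < j \<Longrightarrow> A $ {i, j} = B $ {i, j}"
  shows "A = (B :: ('n::{finite,linorder}) multivector)"
proof -
  have "A $ S = B $ S" for S
  proof (cases "card S = 2")
    case True
    then obtain x y where "S = {x, y}" "x \<noteq> y" unfolding card_2_iff by blast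
    then show ?thesis using assms(3) [of x y] assms(3) [of y x]
      by (metis insert_commute linorder_neqE)
  qed (use assms in \<open>auto simp: grade_def\<close>)
  then show ?thesis by (simp add: vec_eq_iff)
qed

text \<open>For \<open>k < l\<close>, the basis blade of a pair \<open>i < j\<close> has coordinate
  1 at \<open>{k, l}\<close> if the pairs agree and 0 otherwise. The expansion reduces claims linear
  in \<open>B\<close> to wedges of two vectors.\<close>

lemma grade2_expand:
  fixes B :: "('n::{finite,linorder}) multivector"
  assumes "B \<in> grade 2"
  shows "B = (\<Sum>(i, j) | i < j. B $ {i, j} *\<^sub>R (vec1 (axis i 1) \<curlywedge> vec1 (axis j 1)))"
proof (rule grade2_eqI [OF assms])
  let ?R = "\<Sum>(i, j) | i < j. B $ {i, j} *\<^sub>R (vec1 (axis i 1) \<curlywedge> vec1 (axis j 1))"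
  show "?R \<in> grade 2"
    by (auto simp: grade_def wedge2_eq_0 intro!: sum.neutral)
  fix k l :: 'n assume kl: "k < l"
  have "?R $ {k, l} = (\<Sum>p | fst p < snd p. if p = (k, l) then B $ {k, l} else 0)"
    unfolding sum_component
  proof (rule sum.cong)
    fix p :: "'n \<times> 'n" assume p: "p \<in> {p. fst p < snd p}"
    then show "(case p of (i, j) \<Rightarrow> B $ {i, j} *\<^sub>R (vec1 (axis i 1) \<curlywedge> vec1 (axis j 1))) $ {k, l} =
        (if p = (k, l) then B $ {k, l} else 0)"
      using kl by (auto simp: wedge2_nth axis_component split: prod.splits)
  qed auto
  also have "\<dots> = B $ {k, l}" using kl by (simp add: sum.delta)
  finally show "B $ {k, l} = ?R $ {k, l}" by simp
qed

section \<open>Contraction of blades of low grade\<close>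

lemma contract_scal [simp]: "contract a (scal c) = 0"
  by (auto simp: contract_def scal_def axis_def vec_eq_iff)

lemma wedge_scal: "A \<curlywedge> scal c = c *\<^sub>R A"
proof -
  have "scal c = c *\<^sub>R (scal 1 :: 'a multivector)" by (simp add: scal_def)
  then show ?thesis by (metis wedge_scaleR_right wedge_scal_1)
qed

lemma contract_vec1: "contract a (vec1 b) = scal (form33 a b)"
  using contract_vec1_wedge [of a b "scal 1"]
  by (simp add: wedge_scal_1) (simp add: scal_def wedge_def vec_eq_iff)

lemma contract_wedge2:
  "contract z (vec1 a \<curlywedge> vec1 b) = form33 z a *\<^sub>R vec1 b - form33 z b *\<^sub>R vec1 a"
  by (simp add: contract_vec1_wedge contract_vec1 wedge_scal)

lemma contract_wedge3:
  "contract z (vec1 a \<curlywedge> vec1 b \<curlywedge> vec1 c) =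
     form33 z a *\<^sub>R (vec1 b \<curlywedge> vec1 c) - form33 z b *\<^sub>R (vec1 a \<curlywedge> vec1 c) + form33 z c *\<^sub>R (vec1 a \<curlywedge> vec1 b)"
proof -
  have "vec1 a \<curlywedge> (A - B) = vec1 a \<curlywedge> A - vec1 a \<curlywedge> B" for A B
    by (simp add: wedge_def vec_eq_iff algebra_simps sum_subtractf)
  then show ?thesis
    by (simp add: contract_vec1_wedge [of z a] contract_wedge2 wedge_scaleR_right)
qed

lemma form33_commute: "form33 a b = form33 b a"
  by (simp add: form33_def algebra_simps)

section \<open>Clifford commutator of a bivector with a vector\<close>

lemma vmult_scaleR: "vmult a (c *\<^sub>R A) = c *\<^sub>R vmult a A"
  by (simp add: vmult_def contract_scaleR wedge_scaleR_right scaleR_add_right)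

lemma vmult_sum: "vmult a (\<Sum>i\<in>I. f i) = (\<Sum>i\<in>I. vmult a (f i))"
  by (simp add: vmult_def contract_sum wedge_sum_right sum.distrib)

lemma linear_clifford_left: "linear (\<lambda>A. clifford A C)"
proof (rule linearI)
  show "clifford (A + B) C = clifford A C + clifford B C" for A B
    by (simp add: clifford_def scaleR_add_left add_divide_distrib sum.distrib)
  show "clifford (c *\<^sub>R A) C = c *\<^sub>R clifford A C" for c A
    by (simp add: clifford_def scaleR_sum_right mult.assoc)
qed

text \<open>Both products have the same trivector part, since \<open>z\<close> passes two vectors
  and the two sign changes cancel. Their vector parts are opposite, so the difference doubles the
  contraction; the \<open>form33 a b\<close> terms already cancel in the antisymmetrization.\<close>

lemma clifford_commutator_wedge2:
  "clifford (vec1 a \<curlywedge> vec1 b) (vec1 z) - vmult z (vec1 a \<curlywedge> vec1 b) =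
     (-2) *\<^sub>R contract z (vec1 a \<curlywedge> vec1 b)"
proof -
  have vv: "vmult a (vmult b (vec1 z)) = form33 b z *\<^sub>R vec1 a + form33 a b *\<^sub>R vec1 z
      - form33 a z *\<^sub>R vec1 b + vec1 a \<curlywedge> vec1 b \<curlywedge> vec1 z" for a b
    by (simp add: vmult_def contract_add contract_vec1 wedge_add_right wedge_scal contract_wedge2)
  have 1: "vec1 b \<curlywedge> vec1 a \<curlywedge> vec1 z = - (vec1 a \<curlywedge> vec1 b \<curlywedge> vec1 z)"
    by (rule vec1_wedge_swap)
  have neg: "vec1 a \<curlywedge> (- A) = - (vec1 a \<curlywedge> A)" for A
    using wedge_scaleR_right [of "vec1 a" "-1" A] by simp
  have 2: "vec1 z \<curlywedge> vec1 a \<curlywedge> vec1 b = vec1 a \<curlywedge> vec1 b \<curlywedge> vec1 z"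
    using vec1_wedge_swap [of z a "vec1 b"] vec1_wedge_anticommute [of z b] by (simp add: neg)
  show ?thesis
    unfolding clifford_wedge vv 1 unfolding vmult_def contract_wedge2 2
    by (simp add: vec_eq_iff algebra_simps form33_commute [of _ z] form33_commute [of b a])
qed

lemma clifford_commutator_grade2:
  assumes "B \<in> grade 2"
  shows "clifford B (vec1 z) - clifford (vec1 z) B = (-2) *\<^sub>R contract z B"
proof -
  let ?W = "\<lambda>(i, j). B $ {i, j} *\<^sub>R (vec1 (axis i 1) \<curlywedge> vec1 (axis j 1))"
  let ?P = "{(i, j). i < j}"
  have summand: "clifford (?W p) (vec1 z) - vmult z (?W p) = (-2) *\<^sub>R contract z (?W p)" for p
  proof -
    obtain i j where p: "p = (i, j)" by force
    show ?thesis
      unfolding p split_conv linear_cmul [OF linear_clifford_left] vmult_scaleR contract_scaleR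
        scaleR_diff_right [symmetric] clifford_commutator_wedge2
      by simp
  qed
  \<comment> \<open>\<open>B\<close> occurs inside \<open>?W\<close>, so the expansion is only
    folded back, at the very end.\<close>
  have B: "B = sum ?W ?P" by (rule grade2_expand [OF assms])
  have "clifford (sum ?W ?P) (vec1 z) - vmult z (sum ?W ?P) =
      (\<Sum>p\<in>?P. clifford (?W p) (vec1 z) - vmult z (?W p))"
    by (simp only: linear_sum [OF linear_clifford_left] vmult_sum sum_subtractf)
  also have "\<dots> = (-2) *\<^sub>R contract z (sum ?W ?P)"
    by (simp only: summand contract_sum scaleR_sum_right)
  finally show ?thesis unfolding clifford_vec1 B [symmetric] .
qed

section \<open>Nondegeneracy and uniqueness of bivector forms\<close>

lemma col_nth [simp]: "col x y $ Inl i = x $ i" "col x y $ Inr i = y $ i"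
  by (simp_all add: col_def)

lemma E_nth [simp]: "E x $ Inl i = x $ i" "E x $ Inr i = 0" "E' x $ Inl i = 0" "E' x $ Inr i = x $ i"
  by (simp_all add: E_def E'_def)

lemma form33_E: "form33 z (E (axis i 1)) = z $ Inr i"
  and form33_E': "form33 z (E' (axis i 1)) = z $ Inl i"
  by (simp_all add: form33_def axis_component if_distrib [of "(*) _"] cong: if_cong)

text \<open>Contracting with the basis vector dual to index \<open>i\<close> moves the coordinate at
  \<open>S\<close> to \<open>S - {i}\<close>, up to sign. Every contraction kills scalars, whence
  the positive grade.\<close>

lemma contract_nondegenerate:
  assumes "A \<in> grade (Suc k)" "\<And>a. contract a A = 0"
  shows "A = 0"
proof -
  have "A $ S = 0" for S
  proof (cases "S = {}")
    case True
    then show ?thesis using assms(1) by (simp add: grade_def)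
  next
    case False
    then obtain i where i: "i \<in> S" by blast
    \<comment> \<open>The form pairs each \<open>E\<close> basis vector only with its primed
      partner, so the dual index swaps \<open>Inl\<close> and \<open>Inr\<close>.\<close>
    define d where "d = (case i of Inl k \<Rightarrow> Inr k | Inr k \<Rightarrow> Inl k)"
    have f: "form33 (axis d 1) (axis j 1) = (if j = i then 1 else 0)" for j
    proof -
      have "axis (Inl k) 1 = E (axis k 1)" "axis (Inr k) 1 = E' (axis k 1)" for k
        by (auto simp: vec_eq_iff E_def E'_def col_def axis_def split: sum.splits)
      then show ?thesis
        by (cases i; cases j) (auto simp: d_def form33_E form33_E' axis_component)
    qed
    have "contract (axis d 1) A $ (S - {i}) =
        (\<Sum>j\<in>- (S - {i}). if j = i then (-1) ^ card {k\<in>S - {i}. k < i} * A $ S else 0)"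
      unfolding contract_def vec_lambda_beta f
      by (intro sum.cong refl) (use i in \<open>auto simp: insert_absorb\<close>)
    also have "\<dots> = (-1) ^ card {k\<in>S - {i}. k < i} * A $ S"
      by simp
    finally show ?thesis using assms(2) [of "axis d 1"] by simp
  qed
  then show ?thesis by (simp add: vec_eq_iff)
qed

lemma is_bivector_form_unique:
  assumes "is_bivector_form M B" "is_bivector_form M B'"
  shows "B = B'"
proof -
  have g: "B \<in> grade 2" "B' \<in> grade 2" using assms by (auto simp: is_bivector_form_def)
  have "contract z (B - B') = 0" for z
  proof -
    have z: "to_biv4 z \<in> grade 2" using bij_betw_to_biv4 by (auto simp: bij_betw_def)
    \<comment> \<open>Tested at \<open>to_biv4 z\<close>, both commutators with \<open>z\<close>
      equal the same right-hand side.\<close>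
    have "(-2) *\<^sub>R contract z B = (-2) *\<^sub>R contract z B'"
      using assms z g clifford_commutator_grade2 [of _ z]
      unfolding is_bivector_form_def by (metis of_biv4_to_biv4)
    then show ?thesis
      using contract_add [of z "B - B'" B'] by simp
  qed
  then have "B - B' = 0"
    using contract_nondegenerate [of "B - B'" 1] grade_diff [OF g] by (simp add: numeral_2_eq_2)
  then show ?thesis by simp
qed

text \<open>The premise supplies the existence that the definite description needs in addition to
  uniqueness.\<close>

lemma bivector_form_eqI: "is_bivector_form M B \<Longrightarrow> bivector_form M = B"
  unfolding bivector_form_def using is_bivector_form_unique by blast

section \<open>Action of \<open>se3\<close> on bivectors of the four-dimensional space\<close>

lemma linear_tensor_action: "linear (tensor_action M)"
  by (rule linearI)
    (simp_all add: tensor_action_def scaleR_add_left sum.distrib scaleR_sum_right case_prod_beta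
      del: scaleR_add_right)

lemma to_biv4_grade: "to_biv4 X \<in> grade 2"
  using bij_betw_to_biv4 by (auto simp: bij_betw_def)

lemma grade2_4_eqI:
  fixes A B :: "4 multivector"
  assumes "A \<in> grade 2" "B \<in> grade 2"
    and "A $ {0, 1} = B $ {0, 1}" "A $ {0, 2} = B $ {0, 2}" "A $ {0, 3} = B $ {0, 3}"
      "A $ {1, 2} = B $ {1, 2}" "A $ {1, 3} = B $ {1, 3}" "A $ {2, 3} = B $ {2, 3}"
  shows "A = B"
proof (rule grade2_eqI [OF assms(1,2)])
  fix i j :: 4 assume "i < j"
  moreover have "i \<in> {0, 1, 2, 3}" "j \<in> {0, 1, 2, 3}" using UNIV_4' by auto
  ultimately show "A $ {i, j} = B $ {i, j}"
    using assms(3-) by (auto simp: insert_commute)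
qed

text \<open>The matrix sends the basis vector of index 0 to \<open>t\<close> and a spatial vector p
  to v x p. Thus e0 ^ p goes to t ^ p + e0 ^ (v x p), where t ^ p is the primed vector of t x p, and
  a primed vector q goes to v x q. The rotation part \<open>v\<close> is therefore the upper entry
  of \<open>col v t\<close>.\<close>

lemma tensor_action_se3_matrix:
  "tensor_action (se3_matrix t v) (to_biv4 z) = to_biv4 (cross33 (col v t) z)"
proof (rule grade2_4_eqI)
  let ?M = "se3_matrix t v"
  have Mx: "(?M *v axis j 1) $ i = ?M $ i $ j" for i j
    by (simp add: matrix_vector_mult_basis column_def)
  \<comment> \<open>Expanding in wedges instead of sorted coordinates lets
    \<open>tensor_action_wedge\<close> handle the unsorted blade
    \<open>e4 3 \<curlywedge> e4 1\<close> directly.\<close>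
  have exp: "tensor_action ?M (to_biv4 z) =
      z $ Inl 1 *\<^sub>R (vec1 (?M *v axis 0 1) \<curlywedge> e4 1 + e4 0 \<curlywedge> vec1 (?M *v axis 1 1))
    + z $ Inl 2 *\<^sub>R (vec1 (?M *v axis 0 1) \<curlywedge> e4 2 + e4 0 \<curlywedge> vec1 (?M *v axis 2 1))
    + z $ Inl 3 *\<^sub>R (vec1 (?M *v axis 0 1) \<curlywedge> e4 3 + e4 0 \<curlywedge> vec1 (?M *v axis 3 1))
    + z $ Inr 1 *\<^sub>R (vec1 (?M *v axis 2 1) \<curlywedge> e4 3 + e4 2 \<curlywedge> vec1 (?M *v axis 3 1))
    + z $ Inr 2 *\<^sub>R (vec1 (?M *v axis 3 1) \<curlywedge> e4 1 + e4 3 \<curlywedge> vec1 (?M *v axis 1 1))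
    + z $ Inr 3 *\<^sub>R (vec1 (?M *v axis 1 1) \<curlywedge> e4 2 + e4 1 \<curlywedge> vec1 (?M *v axis 2 1))"
    by (simp only: to_biv4_def linear_add [OF linear_tensor_action]
        linear_cmul [OF linear_tensor_action] e4_def tensor_action_wedge)
  show "tensor_action ?M (to_biv4 z) \<in> grade 2"
    unfolding exp e4_def by (intro grade_add grade_scaleR wedge2_grade)
  show "to_biv4 (cross33 (col v t) z) \<in> grade 2"
    by (rule to_biv4_grade)
  note comp = exp e4_def vector_add_component vector_scaleR_component less4 [THEN wedge2_nth]
    axis_component Mx to_biv4_nth
  show "tensor_action ?M (to_biv4 z) $ {0, 1} = to_biv4 (cross33 (col v t) z) $ {0, 1}"
    "tensor_action ?M (to_biv4 z) $ {0, 2} = to_biv4 (cross33 (col v t) z) $ {0, 2}"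
    "tensor_action ?M (to_biv4 z) $ {0, 3} = to_biv4 (cross33 (col v t) z) $ {0, 3}"
    "tensor_action ?M (to_biv4 z) $ {1, 2} = to_biv4 (cross33 (col v t) z) $ {1, 2}"
    "tensor_action ?M (to_biv4 z) $ {1, 3} = to_biv4 (cross33 (col v t) z) $ {1, 3}"
    "tensor_action ?M (to_biv4 z) $ {2, 3} = to_biv4 (cross33 (col v t) z) $ {2, 3}"
    unfolding comp
    by (simp_all add: se3_matrix_def tuple4_def cross33_def col_def cross_components Let_def
        algebra_simps)
qed

section \<open>The trivector \<open>C3\<close> and its contractions\<close>

lemma C3_eq:
  "C3 = EI 1 \<curlywedge> EI' 2 \<curlywedge> EI' 3 + EI 2 \<curlywedge> EI' 3 \<curlywedge> EI' 1 + EI 3 \<curlywedge> EI' 1 \<curlywedge> EI' 2"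
proof -
  have v: "vector [axis 1 1 $ (1::4), axis 1 1 $ (2::4), axis 1 1 $ (3::4)] = (axis 1 1 :: real^3)"
    "vector [axis 2 1 $ (1::4), axis 2 1 $ (2::4), axis 2 1 $ (3::4)] = (axis 2 1 :: real^3)"
    "vector [axis 3 1 $ (1::4), axis 3 1 $ (2::4), axis 3 1 $ (3::4)] = (axis 3 1 :: real^3)"
    by (simp_all add: vec_eq_iff forall_3 axis_component vector_3)
  \<comment> \<open>Contracting \<open>J3\<close> by the second basis vector leaves the sorted pair
    with a minus sign; this turns the cyclic pair into that form.\<close>
  have E31: "EI' 3 \<curlywedge> EI' 1 = (-1) *\<^sub>R (EI' 1 \<curlywedge> EI' 3)"
    using vec1_wedge_anticommute by (simp add: EI'_def)
  have J: "contract (E (axis i 1)) J3 =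
     axis i 1 $ 1 *\<^sub>R (EI' 2 \<curlywedge> EI' 3) + axis i 1 $ 2 *\<^sub>R (EI' 3 \<curlywedge> EI' 1) + axis i 1 $ 3 *\<^sub>R (EI' 1 \<curlywedge> EI' 2)" for i
    unfolding E31 unfolding J3_def EI'_def contract_wedge3 form33_E'
    by (simp add: E_def col_def)
  \<comment> \<open>The coordinate at 0 of the three arguments of \<open>F\<close> vanishes, so only
    the term with \<open>J3\<close> survives, and each contraction of \<open>J3\<close> is a cyclic
    pair.\<close>
  show ?thesis
    unfolding C3_def F_def v Let_def inner33_vec1 J
    by (simp add: axis_component EI_def)
qed

lemma C3_grade: "C3 \<in> grade 3"
proof -
  have "vec1 a \<curlywedge> vec1 b \<curlywedge> vec1 c \<in> grade 3" for a b c :: R33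
    using vec1_wedge_grade [OF wedge2_grade] by (simp add: numeral_3_eq_3 numeral_2_eq_2)
  then show ?thesis unfolding C3_eq EI_def EI'_def by (intro grade_add)
qed

text \<open>In each blade of \<open>C3\<close>, removing the unprimed factor leaves a term of
  \<open>EpEp y\<close>; removing the first primed factor gives a term of \<open>EgtEp x\<close>
  with a minus sign, and removing the second a term of \<open>EltEp x\<close> with a plus
  sign.\<close>

lemma contract_C3:
  "contract (col x y) C3 = EpEp y - (EgtEp x - EltEp x)"
  unfolding C3_eq EpEp_def EgtEp_def EltEp_def EI_def EI'_def contract_add contract_wedge3
    form33_E form33_E'
  by (simp add: col_def algebra_simps)

lemma vec1_col:
  "vec1 (col x y) = x $ 1 *\<^sub>R EI 1 + x $ 2 *\<^sub>R EI 2 + x $ 3 *\<^sub>R EI 3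
     + y $ 1 *\<^sub>R EI' 1 + y $ 2 *\<^sub>R EI' 2 + y $ 3 *\<^sub>R EI' 3"
proof -
  have "col x y = x $ 1 *\<^sub>R E (axis 1 1) + x $ 2 *\<^sub>R E (axis 2 1) + x $ 3 *\<^sub>R E (axis 3 1)
     + y $ 1 *\<^sub>R E' (axis 1 1) + y $ 2 *\<^sub>R E' (axis 2 1) + y $ 3 *\<^sub>R E' (axis 3 1)"
    by (simp add: vec_eq_iff split_sum_all forall_3 E_def E'_def col_def axis_component)
  then show ?thesis by (simp only: vec1_add vec1_scaleR EI_def EI'_def)
qed

lemma col_eta: "col (\<chi> i. X $ Inl i) (\<chi> i. X $ Inr i) = X"
  by (simp add: vec_eq_iff split_sum_all col_def)

text \<open>This serves both claims: the nested contraction is the inner product of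
  \<open>C3\<close> with the wedge of \<open>X\<close> and \<open>Y\<close>, and it also evaluates
  the commutator with a contracted \<open>C3\<close>. Expanding the inner contraction reduces it to
  combinations of the six basis vectors.\<close>

lemma contract_contract_C3: "contract X (contract Y C3) = - vec1 (cross33 X Y)"
proof -
  have diff: "contract X (A - B) = contract X A - contract X B" for A B
    using contract_add [of X "A - B" B] by simp
  have "contract X (contract (col x y) C3) = - vec1 (cross33 X (col x y))" for x y
    unfolding contract_C3 cross33_def Let_def vec1_col EpEp_def EgtEp_def EltEp_def diff contract_add
      contract_scaleR EI_def EI'_def contract_wedge2 form33_E form33_E'
    by (simp add: vec_eq_iff cross_components col_def algebra_simps)
  then show ?thesis by (metis col_eta)
qed

section \<open>The bivector form of a contraction of \<open>C3\<close>, and the theorem\<close>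

lemma is_bivector_form_contract_C3:
  "is_bivector_form (se3_matrix ((-2) *\<^sub>R y) ((-2) *\<^sub>R x)) (contract (col x y) C3)"
  unfolding is_bivector_form_def
proof (intro conjI ballI)
  show g: "contract (col x y) C3 \<in> grade 2"
    unfolding contract_C3 EpEp_def EgtEp_def EltEp_def EI_def EI'_def
    by (intro grade_add grade_diff grade_scaleR wedge2_grade)
  fix A :: "4 multivector" assume "A \<in> grade 2"
  then obtain z where A: "A = to_biv4 z" using bij_betw_to_biv4 by (auto simp: bij_betw_def)
  \<comment> \<open>Antisymmetry absorbs the sign of -2. The commutator gives the same factor 2, as
    -2 times the minus sign of \<open>contract_contract_C3\<close>.\<close>
  have "cross33 (col ((-2) *\<^sub>R x) ((-2) *\<^sub>R y)) z = 2 *\<^sub>R cross33 z (col x y)"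
    by (simp add: vec_eq_iff split_sum_all forall_3 cross33_def Let_def col_def cross_components
        algebra_simps)
  then show "clifford (contract (col x y) C3) (vec1 (of_biv4 A)) -
      clifford (vec1 (of_biv4 A)) (contract (col x y) C3) =
      vec1 (of_biv4 (tensor_action (se3_matrix ((-2) *\<^sub>R y) ((-2) *\<^sub>R x)) A))"
    unfolding A of_biv4_to_biv4 tensor_action_se3_matrix clifford_commutator_grade2 [OF g]
      contract_contract_C3
    by (simp add: vec1_scaleR)
qed

theorem proposition38:
  shows "C3 \<in> grade 3 \<and>
    C3 = EI 1 \<curlywedge> EI' 2 \<curlywedge> EI' 3 + EI 2 \<curlywedge> EI' 3 \<curlywedge> EI' 1 + EI 3 \<curlywedge> EI' 1 \<curlywedge> EI' 2 \<and>
    (\<forall>X Y :: R33. vec1 (cross33 X Y) = - ((vec1 X \<curlywedge> vec1 Y) \<cdot> C3)) \<and>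
    (\<forall>x y :: real ^ 3.
       vec1 (col x y) \<cdot> C3 = EpEp y - (EgtEp x - EltEp x) \<and>
       vec1 (col x y) \<cdot> C3 \<in> bivector_form ` se3)"
proof (intro conjI allI)
  show "C3 \<in> grade 3" by (rule C3_grade)
  show "C3 = EI 1 \<curlywedge> EI' 2 \<curlywedge> EI' 3 + EI 2 \<curlywedge> EI' 3 \<curlywedge> EI' 1 + EI 3 \<curlywedge> EI' 1 \<curlywedge> EI' 2"
    by (rule C3_eq)
  show "vec1 (cross33 X Y) = - ((vec1 X \<curlywedge> vec1 Y) \<cdot> C3)" for X Y
    by (simp add: inner33_wedge inner33_vec1 contract_contract_C3)
  fix x y :: "real ^ 3"
  show "vec1 (col x y) \<cdot> C3 = EpEp y - (EgtEp x - EltEp x)"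
    by (simp only: inner33_vec1 contract_C3)
  have "vec1 (col x y) \<cdot> C3 = bivector_form (se3_matrix ((-2) *\<^sub>R y) ((-2) *\<^sub>R x))"
    by (simp only: inner33_vec1 bivector_form_eqI [OF is_bivector_form_contract_C3])
  then show "vec1 (col x y) \<cdot> C3 \<in> bivector_form ` se3"
    unfolding se3_def by blast
qed

end
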